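(* Let $\epsilon_0<1/2$ and let $Q\in\Psi^{\epsilon_0}_{\mathrm{iso}}(\mathbb{R})$. If $Q$ is bounded on $L^2(\mathbb{R})$, then the symbol $\sigma_L(Q)=q(x,\xi)$ of $Q$ is bounded, i.e. $$\sup_{(x,\xi)\in\mathbb{R}^2}|q(x,\xi)|<\infty.$$
   Context: For $r\in\mathbb{R}$, $S^r_{\mathrm{iso}}(\mathbb{R})$ is the set of $a\in C^\infty(\mathbb{R}^2)$ such that for all $\alpha,\beta\in\mathbb{N}_0=\{0,1,2,\dots\}$ there is $C_{\alpha,\beta}>0$ with $|\partial_x^\alpha\partial_\xi^\beta a(x,\xi)|\le C_{\alpha,\beta}(1+|x|+|\xi|)^{r-\alpha-\beta}$ for all $x,\xi\in\mathbb{R}$. An operator $Q$ on the Schwartz space $\mathcal{S}(\mathbb{R})$ belongs to $\Psi^r_{\mathrm{iso}}(\mathbb{R})$ with (left) symbol $\sigma_L(Q)=q\in S^r_{\mathrm{iso}}(\mathbb{R})$ if for all $u\in\mathcal{S}(\mathbb{R})$, $Qu(x)=\frac{1}{2\pi}\int_{\mathbb{R}}\int_{\mathbb{R}}e^{i(x-y)\xi}q(x,\xi)u(y)\,dy\,d\xi$ (the $y$-integral performed first). "$Q$ is bounded on $L^2(\mathbb{R})$" means there is $C>0$ with $\|Qu\|_{L^2(\mathbb{R})}\le C\|u\|_{L^2(\mathbb{R})}$ for all $u\in\mathcal{S}(\mathbb{R})$. *)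

theory Defs
  imports "HOL-Analysis.Analysis"
begin

text \<open>Partial derivatives of a function of \<open>(x, \<xi>)\<close>; they are meaningful only where the
  derivatives exist, which is what \<open>C_k\<close> below guarantees.\<close>

definition partial_x :: "(real \<times> real \<Rightarrow> complex) \<Rightarrow> real \<times> real \<Rightarrow> complex" where
  "partial_x a = (\<lambda>(x, \<xi>). vector_derivative (\<lambda>t. a (t, \<xi>)) (at x))"

definition partial_xi :: "(real \<times> real \<Rightarrow> complex) \<Rightarrow> real \<times> real \<Rightarrow> complex" where
  "partial_xi a = (\<lambda>(x, \<xi>). vector_derivative (\<lambda>t. a (x, t)) (at \<xi>))"

primrec C_k :: "nat \<Rightarrow> (real \<times> real \<Rightarrow> complex) \<Rightarrow> bool" where
  "C_k 0 a \<longleftrightarrow> continuous_on UNIV a"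
| "C_k (Suc k) a \<longleftrightarrow>
     continuous_on UNIV a \<and>
     (\<forall>x \<xi>. (\<lambda>t. a (t, \<xi>)) differentiable (at x)) \<and>
     (\<forall>x \<xi>. (\<lambda>t. a (x, t)) differentiable (at \<xi>)) \<and>
     C_k k (partial_x a) \<and> C_k k (partial_xi a)"

definition C_infinity :: "(real \<times> real \<Rightarrow> complex) \<Rightarrow> bool" where
  "C_infinity a \<longleftrightarrow> (\<forall>k. C_k k a)"

definition S_iso :: "real \<Rightarrow> (real \<times> real \<Rightarrow> complex) set" where
  "S_iso r = {a. C_infinity a \<and>
     (\<forall>\<alpha> \<beta>. \<exists>C>0. \<forall>x \<xi>.
        cmod ((partial_x ^^ \<alpha>) ((partial_xi ^^ \<beta>) a) (x, \<xi>))
          \<le> C * (1 + \<bar>x\<bar> + \<bar>\<xi>\<bar>) powr (r - real \<alpha> - real \<beta>))}"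

definition nth_deriv :: "nat \<Rightarrow> (real \<Rightarrow> complex) \<Rightarrow> real \<Rightarrow> complex" where
  "nth_deriv n u = ((\<lambda>f x. vector_derivative f (at x)) ^^ n) u"

definition schwartz :: "(real \<Rightarrow> complex) set" where
  "schwartz = {u.
     (\<forall>n x. nth_deriv n u differentiable (at x)) \<and>
     (\<forall>k n. \<exists>C. \<forall>x. \<bar>x\<bar> ^ k * cmod (nth_deriv n u x) \<le> C)}"

definition schwartz_operator :: "((real \<Rightarrow> complex) \<Rightarrow> real \<Rightarrow> complex) \<Rightarrow> bool" where
  "schwartz_operator Q \<longleftrightarrow>
     (\<forall>u\<in>schwartz. Q u \<in> schwartz) \<and>
     (\<forall>u\<in>schwartz. \<forall>v\<in>schwartz. \<forall>c d.
        Q (\<lambda>x. c * u x + d * v x) = (\<lambda>x. c * Q u x + d * Q v x))"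

text \<open>The \<open>y\<close>-integral is the inner one; after it the integrand decays rapidly in \<open>\<xi>\<close>, so for
  \<open>q \<in> S_iso r\<close> and Schwartz \<open>u\<close> both Lebesgue integrals converge absolutely.\<close>

definition left_quantization ::
  "(real \<times> real \<Rightarrow> complex) \<Rightarrow> (real \<Rightarrow> complex) \<Rightarrow> real \<Rightarrow> complex" where
  "left_quantization q u x =
     complex_of_real (1 / (2 * pi)) *
       (LINT \<xi>|lborel. (LINT y|lborel.
          exp (\<i> * complex_of_real ((x - y) * \<xi>)) * q (x, \<xi>) * u y))"

text \<open>\<open>Psi_iso r Q q\<close>: the operator \<open>Q\<close> is an isotropic pseudodifferential operator of order \<open>r\<close>
  with left symbol \<open>q\<close>. Values of \<open>Q\<close> outside the Schwartz space are irrelevant.\<close>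

definition Psi_iso ::
  "real \<Rightarrow> ((real \<Rightarrow> complex) \<Rightarrow> real \<Rightarrow> complex) \<Rightarrow> (real \<times> real \<Rightarrow> complex) \<Rightarrow> bool" where
  "Psi_iso r Q q \<longleftrightarrow>
     schwartz_operator Q \<and> q \<in> S_iso r \<and>
     (\<forall>u\<in>schwartz. \<forall>x. Q u x = left_quantization q u x)"

text \<open>Only applied to Schwartz functions, for which the integral converges.\<close>

definition L2_norm :: "(real \<Rightarrow> complex) \<Rightarrow> real" where
  "L2_norm u = sqrt (LINT x|lborel. (cmod (u x))\<^sup>2)"

definition L2_bounded :: "((real \<Rightarrow> complex) \<Rightarrow> real \<Rightarrow> complex) \<Rightarrow> bool" where
  "L2_bounded Q \<longleftrightarrow> (\<exists>C>0. \<forall>u\<in>schwartz. L2_norm (Q u) \<le> C * L2_norm u)"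

end

theory Submission
  imports Defs "HOL-Probability.Characteristic_Functions" "HOL-Probability.Sinc_Integral"
begin

text \<open>
  A coherent state centred at the phase space point \<open>(x\<^sub>0, \<xi>\<^sub>0)\<close> sees little more of the symbol than its
  value there. A symbol of order at most \<open>1\<close> has bounded first derivatives, so it is Lipschitz
  (\<open>S_iso_lipschitz\<close>), with a constant that is uniform over phase space. For
  \<open>u(y) = e\<^bsup>i\<xi>\<^sub>0y\<^esup> e\<^bsup>-(y - x\<^sub>0)\<^sup>2/2\<^esup>\<close> the Fourier transform of the Gaussian turns the quantization
  into an expectation over a standard normal variable \<open>N\<close>,
  \<open>Q u(x) = e\<^bsup>ix\<xi>\<^sub>0\<^esup> E[e\<^bsup>i(x - x\<^sub>0)N\<^esup> q(x, \<xi>\<^sub>0 + N)]\<close>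
  (\<open>left_quantization_coherent_state\<close>). Replacing \<open>q(x, \<xi>\<^sub>0 + N)\<close> by the constant
  \<open>q(x\<^sub>0, \<xi>\<^sub>0)\<close> gives \<open>q(x\<^sub>0, \<xi>\<^sub>0) u(x)\<close> exactly, because the normal characteristic function is again a
  Gaussian; by the Lipschitz bound the error is at most \<open>M (\<bar>x - x\<^sub>0\<bar> + E\<bar>N\<bar>)\<close>.

  This error bound grows with \<open>\<bar>x - x\<^sub>0\<bar>\<close>, but it is at most \<open>2M\<close> for \<open>x\<^sub>0 \<le> x \<le> x\<^sub>0 + 1\<close>, and the
  \<open>L\<^sup>2\<close> norm of \<open>Q u\<close> dominates the infimum of \<open>\<bar>Q u\<bar>\<close> on that unit interval
  (\<open>L2_norm_ge_on_unit_interval\<close>). Hence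
  \<open>e\<^bsup>-1/2\<^esup> \<bar>q(x\<^sub>0, \<xi>\<^sub>0)\<bar> - 2M \<le> \<parallel>Q u\<parallel> \<le> C \<parallel>u\<parallel>\<close>, and \<open>\<parallel>u\<parallel>\<close> does not depend on the centre.
\<close>

section \<open>Symbols of order at most one are Lipschitz\<close>

lemma norm_diff_le_of_vector_derivative_bound:
  fixes f :: "real \<Rightarrow> complex"
  assumes "\<And>t. f differentiable (at t)"
    and "\<And>t. norm (vector_derivative f (at t)) \<le> B"
  shows "norm (f s - f t) \<le> B * \<bar>s - t\<bar>"
proof -
  have "norm (f s - f t) \<le> B * norm (s - t)"
  proof (rule differentiable_bound[where S = UNIV])
    fix x :: real
    show "(f has_derivative (\<lambda>h. h *\<^sub>R vector_derivative f (at x))) (at x within UNIV)"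
      using assms(1)[of x] by (simp add: vector_derivative_works has_vector_derivative_def)
    show "onorm (\<lambda>h. h *\<^sub>R vector_derivative f (at x)) \<le> B"
      using assms(2)[of x] by (intro onorm_le) (simp add: mult.commute[of B] mult_left_mono)
  qed auto
  then show ?thesis by simp
qed

lemma S_iso_continuous: "q \<in> S_iso r \<Longrightarrow> continuous_on UNIV q"
  unfolding S_iso_def C_infinity_def by (metis (mono_tags, lifting) C_k.simps(1) mem_Collect_eq)

text \<open>Differentiating lowers the order by one, so the first derivatives have order \<open>r - 1 \<le> 0\<close> and
  are bounded; the two axes are then treated one after the other.\<close>

lemma S_iso_lipschitz:
  assumes q: "q \<in> S_iso r" and r: "r \<le> 1"
  obtains M where "M \<ge> 0"
    and "\<And>x \<xi> x' \<xi>'. cmod (q (x, \<xi>) - q (x', \<xi>')) \<le> M * (\<bar>x - x'\<bar> + \<bar>\<xi> - \<xi>'\<bar>)"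
proof -
  have "C_k 1 q"
    using q unfolding S_iso_def C_infinity_def by blast
  then have diff_x: "(\<lambda>t. q (t, \<xi>)) differentiable (at x)"
    and diff_xi: "(\<lambda>t. q (x, t)) differentiable (at \<xi>)" for x \<xi>
    by auto
  have bound: "\<exists>C>0. \<forall>x \<xi>. cmod ((partial_x ^^ \<alpha>) ((partial_xi ^^ \<beta>) q) (x, \<xi>))
                 \<le> C * (1 + \<bar>x\<bar> + \<bar>\<xi>\<bar>) powr (r - real \<alpha> - real \<beta>)" for \<alpha> \<beta>
    using q unfolding S_iso_def by blast
  have le1: "(1 + \<bar>x\<bar> + \<bar>\<xi>\<bar>) powr (r - 1) \<le> 1" for x \<xi> :: real
  proof -
    have "1 + \<bar>x\<bar> + \<bar>\<xi>\<bar> \<noteq> 0" by linarith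
    then show ?thesis using r powr_mono[of "r - 1" 0 "1 + \<bar>x\<bar> + \<bar>\<xi>\<bar>"] by simp
  qed
  from bound[of 1 0] obtain A where A: "A > 0"
    "\<And>x \<xi>. cmod (partial_x q (x, \<xi>)) \<le> A * (1 + \<bar>x\<bar> + \<bar>\<xi>\<bar>) powr (r - 1)" by auto
  from bound[of 0 1] obtain B where B: "B > 0"
    "\<And>x \<xi>. cmod (partial_xi q (x, \<xi>)) \<le> B * (1 + \<bar>x\<bar> + \<bar>\<xi>\<bar>) powr (r - 1)" by auto
  have A': "cmod (partial_x q (x, \<xi>)) \<le> A" for x \<xi>
    using A(2)[of x \<xi>] mult_left_mono[OF le1[of x \<xi>], of A] A(1) by linarith
  have B': "cmod (partial_xi q (x, \<xi>)) \<le> B" for x \<xi>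
    using B(2)[of x \<xi>] mult_left_mono[OF le1[of x \<xi>], of B] B(1) by linarith
  show thesis
  proof (rule that[of "A + B"])
    show "A + B \<ge> 0" using A(1) B(1) by simp
    fix x \<xi> x' \<xi>' :: real
    have "cmod (q (x, \<xi>) - q (x', \<xi>)) \<le> A * \<bar>x - x'\<bar>"
      by (rule norm_diff_le_of_vector_derivative_bound[of "\<lambda>t. q (t, \<xi>)"])
         (use diff_x A' in \<open>auto simp: partial_x_def\<close>)
    moreover have "cmod (q (x', \<xi>) - q (x', \<xi>')) \<le> B * \<bar>\<xi> - \<xi>'\<bar>"
      by (rule norm_diff_le_of_vector_derivative_bound[of "\<lambda>t. q (x', t)"])
         (use diff_xi B' in \<open>auto simp: partial_xi_def\<close>)
    moreover have "cmod (q (x, \<xi>) - q (x', \<xi>'))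
        \<le> cmod (q (x, \<xi>) - q (x', \<xi>)) + cmod (q (x', \<xi>) - q (x', \<xi>'))"
      using norm_triangle_ineq[of "q (x, \<xi>) - q (x', \<xi>)" "q (x', \<xi>) - q (x', \<xi>')"] by simp
    moreover have "0 \<le> A * \<bar>\<xi> - \<xi>'\<bar>" "0 \<le> B * \<bar>x - x'\<bar>"
      using A(1) B(1) by auto
    ultimately show "cmod (q (x, \<xi>) - q (x', \<xi>')) \<le> (A + B) * (\<bar>x - x'\<bar> + \<bar>\<xi> - \<xi>'\<bar>)"
      by (simp add: algebra_simps)
  qed
qed

section \<open>Coherent states\<close>

text \<open>The Gaussian wave packet of unit width at the phase space point \<open>(x\<^sub>0, \<xi>\<^sub>0)\<close>, without the
  normalizing factor \<open>\<pi>\<^bsup>-1/4\<^esup>\<close>.\<close>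

definition coherent_state :: "real \<Rightarrow> real \<Rightarrow> real \<Rightarrow> complex" where
  "coherent_state x\<^sub>0 \<xi>\<^sub>0 y = iexp (\<xi>\<^sub>0 * y) * complex_of_real (exp (- ((y - x\<^sub>0)\<^sup>2 / 2)))"

lemma cmod_coherent_state: "cmod (coherent_state x\<^sub>0 \<xi>\<^sub>0 y) = exp (- ((y - x\<^sub>0)\<^sup>2 / 2))"
  unfolding coherent_state_def by (simp add: norm_mult)

lemma coherent_state_has_vector_derivative:
  "(coherent_state x\<^sub>0 \<xi>\<^sub>0 has_vector_derivative
     (\<i> * of_real \<xi>\<^sub>0 + of_real x\<^sub>0 - of_real y) * coherent_state x\<^sub>0 \<xi>\<^sub>0 y) (at y)"
proof -
  \<comment> \<open>The formula is entire in \<open>y\<close>, so the derivative can be taken over the complex field and restricted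
     to the real line.\<close>
  let ?g = "\<lambda>z::complex. exp (\<i> * (of_real \<xi>\<^sub>0 * z)) * exp (- ((z - of_real x\<^sub>0)\<^sup>2 / 2))"
  have "(?g has_field_derivative
          (\<i> * of_real \<xi>\<^sub>0 + of_real x\<^sub>0 - of_real y) * ?g (of_real y)) (at (of_real y))"
    by (auto intro!: derivative_eq_intros simp: field_simps)
  then have "((\<lambda>t. ?g (of_real t)) has_vector_derivative
          (\<i> * of_real \<xi>\<^sub>0 + of_real x\<^sub>0 - of_real y) * ?g (of_real y)) (at y)"
    by (rule has_vector_derivative_real_field)
  moreover have "coherent_state x\<^sub>0 \<xi>\<^sub>0 = (\<lambda>t. ?g (of_real t))"
    by (rule ext) (simp add: coherent_state_def exp_of_real flip: exp_of_real)
  ultimately show ?thesis by simp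
qed

text \<open>With \<open>coherent_state_has_vector_derivative\<close>, differentiating \<open>p u\<close> replaces the polynomial \<open>p\<close> by
  \<open>p' + (i\<xi>\<^sub>0 + x\<^sub>0 - y) p\<close>.\<close>

lemma nth_deriv_coherent_state:
  "\<exists>p. nth_deriv n (coherent_state x\<^sub>0 \<xi>\<^sub>0) = (\<lambda>y. poly p (of_real y) * coherent_state x\<^sub>0 \<xi>\<^sub>0 y)"
proof (induction n)
  case 0
  show ?case by (rule exI[of _ 1]) (simp add: nth_deriv_def)
next
  case (Suc n)
  then obtain p where p: "nth_deriv n (coherent_state x\<^sub>0 \<xi>\<^sub>0)
      = (\<lambda>y. poly p (of_real y) * coherent_state x\<^sub>0 \<xi>\<^sub>0 y)" by blast
  let ?p' = "pderiv p + p * [:\<i> * of_real \<xi>\<^sub>0 + of_real x\<^sub>0, -1:]"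
  have "((\<lambda>y. poly p (of_real y) * coherent_state x\<^sub>0 \<xi>\<^sub>0 y) has_vector_derivative
          poly ?p' (of_real y) * coherent_state x\<^sub>0 \<xi>\<^sub>0 y) (at y)" for y
  proof -
    have "((\<lambda>y. poly p (of_real y)) has_vector_derivative poly (pderiv p) (of_real y)) (at y)"
      by (intro has_vector_derivative_real_field poly_DERIV)
    from has_vector_derivative_mult[OF this coherent_state_has_vector_derivative[of x\<^sub>0 \<xi>\<^sub>0 y]]
    show ?thesis by (simp add: algebra_simps)
  qed
  then have "nth_deriv (Suc n) (coherent_state x\<^sub>0 \<xi>\<^sub>0)
      = (\<lambda>y. poly ?p' (of_real y) * coherent_state x\<^sub>0 \<xi>\<^sub>0 y)"
    using p by (auto simp: nth_deriv_def intro!: ext vector_derivative_at)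
  then show ?case by blast
qed

text \<open>The term \<open>\<bar>y\<bar>\<^sup>k / k!\<close> of the exponential series gives \<open>\<bar>y\<bar>\<^sup>k \<le> k! e\<^bsup>\<bar>y\<bar>\<^esup>\<close>, and the maximum of
  \<open>\<bar>t\<bar> - t\<^sup>2/2\<close> is \<open>1/2\<close>.\<close>

lemma power_times_gaussian_bounded:
  fixes x\<^sub>0 y :: real
  shows "\<bar>y\<bar> ^ k * exp (- ((y - x\<^sub>0)\<^sup>2 / 2)) \<le> fact k * exp (\<bar>x\<^sub>0\<bar> + 1 / 2)"
proof -
  have "\<bar>y\<bar> ^ k / fact k \<le> exp \<bar>y\<bar>"
  proof -
    have "(\<lambda>n. \<bar>y\<bar> ^ n / fact n) sums exp \<bar>y\<bar>"
      using exp_converges[of "\<bar>y\<bar>"] by (simp add: divide_inverse mult.commute)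
    from sum_le_suminf[OF sums_summable[OF this], of "{k}"] sums_unique[OF this]
    show ?thesis by simp
  qed
  then have "\<bar>y\<bar> ^ k \<le> fact k * exp \<bar>y\<bar>" by (simp add: field_simps)
  then have "\<bar>y\<bar> ^ k * exp (- ((y - x\<^sub>0)\<^sup>2 / 2))
      \<le> fact k * exp \<bar>y\<bar> * exp (- ((y - x\<^sub>0)\<^sup>2 / 2))"
    by (rule mult_right_mono) simp
  also have "\<dots> = fact k * exp (\<bar>y\<bar> - (y - x\<^sub>0)\<^sup>2 / 2)"
    by (simp only: mult.assoc exp_add[symmetric] diff_conv_add_uminus)
  also have "\<bar>y\<bar> - (y - x\<^sub>0)\<^sup>2 / 2 \<le> \<bar>x\<^sub>0\<bar> + 1 / 2"
  proof -
    have "0 \<le> (\<bar>y - x\<^sub>0\<bar> - 1)\<^sup>2" by simp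
    then have "\<bar>y - x\<^sub>0\<bar> \<le> (y - x\<^sub>0)\<^sup>2 / 2 + 1 / 2"
      by (simp add: power2_diff diff_divide_distrib add_divide_distrib)
    then show ?thesis by linarith
  qed
  finally show ?thesis by simp
qed

lemma poly_times_coherent_state_bounded:
  "\<exists>C. \<forall>y. cmod (poly p (of_real y) * coherent_state x\<^sub>0 \<xi>\<^sub>0 y) \<le> C"
proof -
  have "cmod (poly p (of_real y) * coherent_state x\<^sub>0 \<xi>\<^sub>0 y)
      \<le> (\<Sum>i\<le>degree p. cmod (coeff p i) * (fact i * exp (\<bar>x\<^sub>0\<bar> + 1 / 2)))" for y
  proof -
    have "cmod (poly p (of_real y)) \<le> (\<Sum>i\<le>degree p. cmod (coeff p i) * \<bar>y\<bar> ^ i)"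
      unfolding poly_altdef
      by (rule order_trans[OF norm_sum]) (simp add: norm_mult norm_power)
    then have "cmod (poly p (of_real y) * coherent_state x\<^sub>0 \<xi>\<^sub>0 y)
        \<le> (\<Sum>i\<le>degree p. cmod (coeff p i) * \<bar>y\<bar> ^ i) * exp (- ((y - x\<^sub>0)\<^sup>2 / 2))"
      unfolding norm_mult cmod_coherent_state by (intro mult_right_mono) auto
    also have "\<dots> = (\<Sum>i\<le>degree p. cmod (coeff p i) * (\<bar>y\<bar> ^ i * exp (- ((y - x\<^sub>0)\<^sup>2 / 2))))"
      by (simp add: sum_distrib_right mult.assoc)
    also have "\<dots> \<le> (\<Sum>i\<le>degree p. cmod (coeff p i) * (fact i * exp (\<bar>x\<^sub>0\<bar> + 1 / 2)))"
      by (intro sum_mono mult_left_mono power_times_gaussian_bounded) auto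
    finally show ?thesis .
  qed
  then show ?thesis by blast
qed

lemma coherent_state_schwartz: "coherent_state x\<^sub>0 \<xi>\<^sub>0 \<in> schwartz"
proof -
  have "nth_deriv n (coherent_state x\<^sub>0 \<xi>\<^sub>0) differentiable (at x)" for n x
  proof -
    obtain p where p: "nth_deriv n (coherent_state x\<^sub>0 \<xi>\<^sub>0)
        = (\<lambda>y. poly p (of_real y) * coherent_state x\<^sub>0 \<xi>\<^sub>0 y)"
      using nth_deriv_coherent_state by blast
    have "((\<lambda>y. poly p (of_real y)) has_vector_derivative poly (pderiv p) (of_real x)) (at x)"
      by (intro has_vector_derivative_real_field poly_DERIV)
    from has_vector_derivative_mult[OF this coherent_state_has_vector_derivative]
    show ?thesis unfolding p by (rule differentiableI_vector)
  qed
  moreover have "\<exists>C. \<forall>x. \<bar>x\<bar> ^ k * cmod (nth_deriv n (coherent_state x\<^sub>0 \<xi>\<^sub>0) x) \<le> C" for k n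
  proof -
    obtain p where p: "nth_deriv n (coherent_state x\<^sub>0 \<xi>\<^sub>0)
        = (\<lambda>y. poly p (of_real y) * coherent_state x\<^sub>0 \<xi>\<^sub>0 y)"
      using nth_deriv_coherent_state by blast
    show ?thesis
      using poly_times_coherent_state_bounded[of "monom 1 k * p" x\<^sub>0 \<xi>\<^sub>0]
      by (simp add: p norm_mult norm_power poly_monom mult.assoc)
  qed
  ultimately show ?thesis unfolding schwartz_def by blast
qed

lemma L2_norm_coherent_state: "L2_norm (coherent_state x\<^sub>0 \<xi>\<^sub>0) = L2_norm (coherent_state 0 0)"
  unfolding L2_norm_def cmod_coherent_state
  by (subst lborel_integral_real_affine[of 1 _ x\<^sub>0]) auto

section \<open>The operator on coherent states\<close>

text \<open>Up to phases, this is the Fourier transform of a Gaussian at the frequency \<open>\<xi> - \<xi>\<^sub>0\<close>. Writing the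
  result with the normal density makes the outer integral an expectation; the constant is \<open>2\<pi>\<close>
  because one factor \<open>\<surd>(2\<pi>)\<close> comes from each of the two Gaussian normalizations, and it
  cancels the prefactor of the quantization.\<close>

lemma coherent_state_inner_integral:
  "(LINT y|lborel. exp (\<i> * complex_of_real ((x - y) * \<xi>)) * c * coherent_state x\<^sub>0 \<xi>\<^sub>0 y)
     = complex_of_real (2 * pi) * iexp (x * \<xi>\<^sub>0)
         * (std_normal_density (\<xi> - \<xi>\<^sub>0) *\<^sub>R (iexp ((x - x\<^sub>0) * (\<xi> - \<xi>\<^sub>0)) * c))"
proof -
  let ?\<eta> = "\<xi> - \<xi>\<^sub>0"
  let ?K = "complex_of_real (sqrt (2 * pi)) * c * iexp (x * \<xi>\<^sub>0) * iexp ((x - x\<^sub>0) * ?\<eta>)"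
  have "(LINT y|lborel. exp (\<i> * complex_of_real ((x - y) * \<xi>)) * c * coherent_state x\<^sub>0 \<xi>\<^sub>0 y)
      = (LINT z|lborel. exp (\<i> * complex_of_real ((x - (x\<^sub>0 + z)) * \<xi>)) * c
                          * coherent_state x\<^sub>0 \<xi>\<^sub>0 (x\<^sub>0 + z))"
    by (subst lborel_integral_real_affine[of 1 _ x\<^sub>0]) auto
  also have "\<dots> = (LINT z|lborel. ?K * (std_normal_density z *\<^sub>R iexp (- ?\<eta> * z)))"
  proof (rule Bochner_Integration.integral_cong[OF refl])
    fix z :: real
    \<comment> \<open>With \<open>y = x\<^sub>0 + z\<close> only the last term of the phase depends on \<open>z\<close>.\<close>
    have phase: "(x - (x\<^sub>0 + z)) * \<xi> + \<xi>\<^sub>0 * (x\<^sub>0 + z) = x * \<xi>\<^sub>0 + (x - x\<^sub>0) * ?\<eta> + - ?\<eta> * z"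
      by (simp add: algebra_simps)
    have "iexp ((x - (x\<^sub>0 + z)) * \<xi>) * iexp (\<xi>\<^sub>0 * (x\<^sub>0 + z))
        = iexp ((x - (x\<^sub>0 + z)) * \<xi> + \<xi>\<^sub>0 * (x\<^sub>0 + z))"
      by (simp only: of_real_add distrib_left exp_add)
    also have "\<dots> = iexp (x * \<xi>\<^sub>0) * iexp ((x - x\<^sub>0) * ?\<eta>) * iexp (- ?\<eta> * z)"
      unfolding phase by (simp only: of_real_add distrib_left exp_add)
    finally have ph: "iexp ((x - (x\<^sub>0 + z)) * \<xi>) * iexp (\<xi>\<^sub>0 * (x\<^sub>0 + z))
        = iexp (x * \<xi>\<^sub>0) * iexp ((x - x\<^sub>0) * ?\<eta>) * iexp (- ?\<eta> * z)" .
    have g: "complex_of_real (exp (- ((x\<^sub>0 + z - x\<^sub>0)\<^sup>2 / 2)))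
        = complex_of_real (sqrt (2 * pi)) * complex_of_real (std_normal_density z)"
      unfolding of_real_mult[symmetric] by (simp add: std_normal_density_def)
    show "exp (\<i> * complex_of_real ((x - (x\<^sub>0 + z)) * \<xi>)) * c * coherent_state x\<^sub>0 \<xi>\<^sub>0 (x\<^sub>0 + z)
        = ?K * (std_normal_density z *\<^sub>R iexp (- ?\<eta> * z))"
      unfolding coherent_state_def g scaleR_conv_of_real using ph by (simp only: ac_simps)
  qed
  also have "\<dots> = ?K * (LINT z|std_normal_distribution. iexp (- ?\<eta> * z))"
    unfolding Bochner_Integration.integral_mult_right_zero by (subst integral_density) auto
  also have "(LINT z|std_normal_distribution. iexp (- ?\<eta> * z)) = of_real (exp (- ?\<eta>\<^sup>2 / 2))"
    using fun_cong[OF char_std_normal_distribution, of "- ?\<eta>"] unfolding char_def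
    by (simp add: power2_commute[of \<xi>\<^sub>0 \<xi>])
  also have "exp (- ?\<eta>\<^sup>2 / 2) = sqrt (2 * pi) * std_normal_density ?\<eta>"
    by (simp add: std_normal_density_def)
  also have "?K * complex_of_real (sqrt (2 * pi) * std_normal_density ?\<eta>)
      = complex_of_real (sqrt (2 * pi) * sqrt (2 * pi)) * iexp (x * \<xi>\<^sub>0)
          * (std_normal_density ?\<eta> *\<^sub>R (iexp ((x - x\<^sub>0) * ?\<eta>) * c))"
    unfolding scaleR_conv_of_real of_real_mult by (simp only: ac_simps)
  also have "sqrt (2 * pi) * sqrt (2 * pi) = 2 * pi"
    by simp
  finally show ?thesis .
qed

lemma left_quantization_coherent_state:
  assumes q: "continuous_on UNIV q"
  shows "left_quantization q (coherent_state x\<^sub>0 \<xi>\<^sub>0) x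
     = iexp (x * \<xi>\<^sub>0) * (LINT \<eta>|std_normal_distribution. iexp ((x - x\<^sub>0) * \<eta>) * q (x, \<xi>\<^sub>0 + \<eta>))"
proof -
  have [measurable]: "(\<lambda>\<eta>. q (x, \<xi>\<^sub>0 + \<eta>)) \<in> borel_measurable borel"
    by (intro borel_measurable_continuous_onI continuous_on_compose2[OF q] continuous_intros) auto
  have "left_quantization q (coherent_state x\<^sub>0 \<xi>\<^sub>0) x
     = iexp (x * \<xi>\<^sub>0) * (LINT \<xi>|lborel. std_normal_density (\<xi> - \<xi>\<^sub>0)
                          *\<^sub>R (iexp ((x - x\<^sub>0) * (\<xi> - \<xi>\<^sub>0)) * q (x, \<xi>)))"
    unfolding left_quantization_def coherent_state_inner_integral
      Bochner_Integration.integral_mult_right_zero by simp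
  also have "\<dots> = iexp (x * \<xi>\<^sub>0) * (LINT \<eta>|lborel. std_normal_density \<eta>
                          *\<^sub>R (iexp ((x - x\<^sub>0) * \<eta>) * q (x, \<xi>\<^sub>0 + \<eta>)))"
    by (subst lborel_integral_real_affine[of 1 _ \<xi>\<^sub>0]) auto
  finally show ?thesis
    by (subst integral_density) auto
qed

text \<open>The constant \<open>q (x\<^sub>0, \<xi>\<^sub>0)\<close> contributes the characteristic function of the normal
  distribution at \<open>x - x\<^sub>0\<close>. The rest is at most \<open>M (\<bar>x - x\<^sub>0\<bar> + E\<bar>N\<bar>)\<close>, where
  \<open>E\<bar>N\<bar> = \<surd>(2/\<pi>) \<le> 1\<close>.\<close>

lemma left_quantization_coherent_state_lower_bound:
  assumes q: "continuous_on UNIV q" and M: "M \<ge> 0"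
    and lip: "\<And>x \<xi> x' \<xi>'. cmod (q (x, \<xi>) - q (x', \<xi>')) \<le> M * (\<bar>x - x'\<bar> + \<bar>\<xi> - \<xi>'\<bar>)"
  shows "cmod (q (x\<^sub>0, \<xi>\<^sub>0)) * exp (- ((x - x\<^sub>0)\<^sup>2 / 2)) - M * (\<bar>x - x\<^sub>0\<bar> + 1)
    \<le> cmod (left_quantization q (coherent_state x\<^sub>0 \<xi>\<^sub>0) x)"
proof -
  interpret N: real_distribution std_normal_distribution
    by (rule real_dist_normal_dist)
  let ?N = std_normal_distribution
  have [measurable]: "(\<lambda>\<eta>. q (x, \<xi>\<^sub>0 + \<eta>)) \<in> borel_measurable borel"
    by (intro borel_measurable_continuous_onI continuous_on_compose2[OF q] continuous_intros) auto
  have int_abs: "integrable ?N (\<lambda>\<eta>. \<bar>\<eta>\<bar>)"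
    using integrable_std_normal_distribution_moment[of 1] by (auto intro: integrable_abs)
  have E_abs: "(LINT \<eta>|?N. \<bar>\<eta>\<bar>) \<le> 1"
  proof -
    have "(LINT \<eta>|?N. \<bar>\<eta>\<bar>) = sqrt (2 / pi)"
      using std_normal_distribution_odd_moments_abs[of 0] by simp
    also have "\<dots> \<le> 1"
      using pi_ge_two by simp
    finally show ?thesis .
  qed
  have int_dom: "integrable ?N (\<lambda>\<eta>. M * (\<bar>x - x\<^sub>0\<bar> + \<bar>\<eta>\<bar>))"
    using int_abs by auto
  let ?R = "\<lambda>\<eta>. iexp ((x - x\<^sub>0) * \<eta>) * (q (x, \<xi>\<^sub>0 + \<eta>) - q (x\<^sub>0, \<xi>\<^sub>0))"
  have R_le: "cmod (?R \<eta>) \<le> M * (\<bar>x - x\<^sub>0\<bar> + \<bar>\<eta>\<bar>)" for \<eta>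
    using lip[of x "\<xi>\<^sub>0 + \<eta>" x\<^sub>0 \<xi>\<^sub>0] by (simp add: norm_mult)
  have int_R: "integrable ?N ?R"
  proof (rule Bochner_Integration.integrable_bound[OF int_dom])
    show "?R \<in> borel_measurable ?N" by simp
    show "AE \<eta> in ?N. norm (?R \<eta>) \<le> norm (M * (\<bar>x - x\<^sub>0\<bar> + \<bar>\<eta>\<bar>))"
      by (rule AE_I2) (rule order_trans[OF R_le], simp)
  qed
  have int_c: "integrable ?N (\<lambda>\<eta>. iexp ((x - x\<^sub>0) * \<eta>) * q (x\<^sub>0, \<xi>\<^sub>0))"
    by (intro N.integrable_const_bound[of _ "cmod (q (x\<^sub>0, \<xi>\<^sub>0))"]) (auto simp: norm_mult)
  define I where "I = (LINT \<eta>|?N. ?R \<eta>)"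
  let ?main = "complex_of_real (exp (- ((x - x\<^sub>0)\<^sup>2 / 2))) * q (x\<^sub>0, \<xi>\<^sub>0)"
  have "(LINT \<eta>|?N. iexp ((x - x\<^sub>0) * \<eta>) * q (x, \<xi>\<^sub>0 + \<eta>))
      = (LINT \<eta>|?N. iexp ((x - x\<^sub>0) * \<eta>) * q (x\<^sub>0, \<xi>\<^sub>0) + ?R \<eta>)"
    by (simp add: algebra_simps)
  also have "\<dots> = (LINT \<eta>|?N. iexp ((x - x\<^sub>0) * \<eta>) * q (x\<^sub>0, \<xi>\<^sub>0)) + I"
    unfolding I_def by (rule Bochner_Integration.integral_add[OF int_c int_R])
  also have "(LINT \<eta>|?N. iexp ((x - x\<^sub>0) * \<eta>) * q (x\<^sub>0, \<xi>\<^sub>0)) = ?main"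
    using fun_cong[OF char_std_normal_distribution, of "x - x\<^sub>0"] unfolding char_def by simp
  finally have "cmod (left_quantization q (coherent_state x\<^sub>0 \<xi>\<^sub>0) x) = cmod (?main + I)"
    unfolding left_quantization_coherent_state[OF q] by (simp add: norm_mult)
  moreover have "cmod I \<le> M * (\<bar>x - x\<^sub>0\<bar> + 1)"
  proof -
    have "cmod I \<le> (LINT \<eta>|?N. M * (\<bar>x - x\<^sub>0\<bar> + \<bar>\<eta>\<bar>))"
      unfolding I_def
      by (rule Bochner_Integration.integral_norm_bound_integral[OF int_R int_dom R_le])
    also have "\<dots> = M * (\<bar>x - x\<^sub>0\<bar> + (LINT \<eta>|?N. \<bar>\<eta>\<bar>))"
      using int_abs N.prob_space by simp
    also have "\<dots> \<le> M * (\<bar>x - x\<^sub>0\<bar> + 1)"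
      using E_abs M by (intro mult_left_mono) auto
    finally show ?thesis .
  qed
  moreover have "cmod ?main - cmod I \<le> cmod (?main + I)"
    by (rule norm_diff_ineq)
  moreover have "cmod ?main = cmod (q (x\<^sub>0, \<xi>\<^sub>0)) * exp (- ((x - x\<^sub>0)\<^sup>2 / 2))"
    by (simp add: norm_mult)
  ultimately show ?thesis
    by linarith
qed

section \<open>Local lower bounds for the L2 norm\<close>

text \<open>A Bochner integral that does not converge has value \<open>0\<close>, so a lower bound for \<open>L2_norm\<close> needs
  square integrability. The decay of \<open>f\<close> and of \<open>x f(x)\<close> gives the dominating function
  \<open>(A\<^sup>2 + B\<^sup>2) / (1 + x\<^sup>2)\<close>.\<close>

lemma schwartz_square_integrable:
  assumes "f \<in> schwartz"
  shows "integrable lborel (\<lambda>x. (cmod (f x))\<^sup>2)"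
proof -
  have diff: "f differentiable (at x)" for x
  proof -
    have "nth_deriv 0 f differentiable (at x)"
      using assms unfolding schwartz_def by blast
    then show ?thesis by (simp add: nth_deriv_def)
  qed
  then have "continuous_on UNIV f"
    by (simp add: continuous_on_eq_continuous_at differentiable_imp_continuous_within)
  then have [measurable]: "f \<in> borel_measurable borel"
    by (rule borel_measurable_continuous_onI)
  have decay: "\<exists>C. \<forall>x. \<bar>x\<bar> ^ k * cmod (f x) \<le> C" for k
    
  proof -
    have "\<exists>C. \<forall>x. \<bar>x\<bar> ^ k * cmod (nth_deriv 0 f x) \<le> C"
      using assms unfolding schwartz_def by blast
    then show ?thesis by (simp add: nth_deriv_def)
  qed
  obtain A where A: "\<And>x. cmod (f x) \<le> A" using decay[of 0] by auto
  obtain B where B: "\<And>x. \<bar>x\<bar> ^ 1 * cmod (f x) \<le> B" using decay[of 1] by auto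
  have "integrable lborel (\<lambda>x::real. inverse (1 + x\<^sup>2))"
    using integrable_inverse_1_plus_square by (simp add: set_integrable_def)
  then have dom: "integrable lborel (\<lambda>x::real. (A\<^sup>2 + B\<^sup>2) * inverse (1 + x\<^sup>2))"
    by simp
  show ?thesis
  proof (rule Bochner_Integration.integrable_bound[OF dom])
    show "AE x in lborel. norm ((cmod (f x))\<^sup>2) \<le> norm ((A\<^sup>2 + B\<^sup>2) * inverse (1 + x\<^sup>2))"
    proof (rule AE_I2)
      fix x :: real
      have "(cmod (f x))\<^sup>2 \<le> A\<^sup>2" using A[of x] by (intro power_mono) auto
      moreover have "(\<bar>x\<bar> * cmod (f x))\<^sup>2 \<le> B\<^sup>2" using B[of x] by (intro power_mono) auto
      ultimately have "(cmod (f x))\<^sup>2 * (1 + x\<^sup>2) \<le> A\<^sup>2 + B\<^sup>2"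
        by (simp add: power_mult_distrib algebra_simps)
      moreover have "1 + x\<^sup>2 > 0" by (simp add: add_pos_nonneg)
      ultimately show "norm ((cmod (f x))\<^sup>2) \<le> norm ((A\<^sup>2 + B\<^sup>2) * inverse (1 + x\<^sup>2))"
        by (simp add: field_simps)
    qed
  qed measurable
qed

lemma L2_norm_ge_on_unit_interval:
  assumes f: "f \<in> schwartz" and "b \<ge> 0" and lower: "\<And>x. x \<in> {a..a + 1} \<Longrightarrow> b \<le> cmod (f x)"
  shows "b \<le> L2_norm f"
proof -
  have "b\<^sup>2 = (LINT x|lborel. indicator {a..a + 1} x * b\<^sup>2)"
    by simp
  also have "\<dots> \<le> (LINT x|lborel. (cmod (f x))\<^sup>2)"
  proof (rule integral_mono)
    show "integrable lborel (\<lambda>x. indicator {a..a + 1} x * b\<^sup>2)"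
      by (intro integrable_mult_left integrable_real_indicator) auto
    show "integrable lborel (\<lambda>x. (cmod (f x))\<^sup>2)"
      by (rule schwartz_square_integrable[OF f])
    show "indicator {a..a + 1} x * b\<^sup>2 \<le> (cmod (f x))\<^sup>2" for x
      using lower[of x] \<open>b \<ge> 0\<close> by (auto simp: indicator_def intro: power_mono)
  qed
  finally show ?thesis
    unfolding L2_norm_def by (rule real_le_rsqrt)
qed

section \<open>Boundedness of the symbol\<close>

theorem lemmaC1:
  fixes \<epsilon>\<^sub>0 :: real
    and Q :: "(real \<Rightarrow> complex) \<Rightarrow> real \<Rightarrow> complex"
    and q :: "real \<times> real \<Rightarrow> complex"
  assumes "\<epsilon>\<^sub>0 < 1 / 2"
    and "Psi_iso \<epsilon>\<^sub>0 Q q"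
    and "L2_bounded Q"
  shows "(SUP (x, \<xi>)\<in>UNIV. ereal (cmod (q (x, \<xi>)))) < \<infinity>"
proof -
  have q: "q \<in> S_iso \<epsilon>\<^sub>0" and Q: "schwartz_operator Q"
    and Qq: "\<And>u x. u \<in> schwartz \<Longrightarrow> Q u x = left_quantization q u x"
    using assms(2) unfolding Psi_iso_def by auto
  obtain M where M: "M \<ge> 0"
    "\<And>x \<xi> x' \<xi>'. cmod (q (x, \<xi>) - q (x', \<xi>')) \<le> M * (\<bar>x - x'\<bar> + \<bar>\<xi> - \<xi>'\<bar>)"
    using S_iso_lipschitz[OF q] assms(1) by auto
  obtain C where C: "\<And>u. u \<in> schwartz \<Longrightarrow> L2_norm (Q u) \<le> C * L2_norm u"
    using assms(3) unfolding L2_bounded_def by blast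
  define K where "K = max 0 (C * L2_norm (coherent_state 0 0))"
  define D where "D = (K + 2 * M) * exp (1 / 2)"
  have bound: "cmod (q (x\<^sub>0, \<xi>\<^sub>0)) \<le> D" for x\<^sub>0 \<xi>\<^sub>0
  proof -
    let ?u = "coherent_state x\<^sub>0 \<xi>\<^sub>0"
    define b where "b = cmod (q (x\<^sub>0, \<xi>\<^sub>0)) * exp (- (1 / 2)) - 2 * M"
    have "b \<le> K"
    (* The lower bound for the norm applies to b >= 0 only; a negative b is below K because K >= 0. *)
    proof (cases "b \<ge> 0")
      case True
      have "b \<le> L2_norm (Q ?u)"
      proof (rule L2_norm_ge_on_unit_interval[where a = x\<^sub>0, OF _ True])
        show "Q ?u \<in> schwartz"
          using Q coherent_state_schwartz unfolding schwartz_operator_def by blast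
        fix x assume x: "x \<in> {x\<^sub>0..x\<^sub>0 + 1}"
        then have "(x - x\<^sub>0)\<^sup>2 \<le> 1" by (intro power_le_one) auto
        then have "cmod (q (x\<^sub>0, \<xi>\<^sub>0)) * exp (- (1 / 2))
            \<le> cmod (q (x\<^sub>0, \<xi>\<^sub>0)) * exp (- ((x - x\<^sub>0)\<^sup>2 / 2))"
          by (intro mult_left_mono) auto
        moreover have "M * (\<bar>x - x\<^sub>0\<bar> + 1) \<le> 2 * M"
          using mult_left_mono[of "\<bar>x - x\<^sub>0\<bar> + 1" 2 M] M(1) x by (simp add: mult.commute)
        ultimately show "b \<le> cmod (Q ?u x)"
          using left_quantization_coherent_state_lower_bound[OF S_iso_continuous[OF q] M, of x\<^sub>0 \<xi>\<^sub>0 x]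
          unfolding b_def Qq[OF coherent_state_schwartz] by linarith
      qed
      also have "\<dots> \<le> C * L2_norm ?u"
        by (rule C[OF coherent_state_schwartz])
      also have "\<dots> \<le> K"
        unfolding L2_norm_coherent_state[of x\<^sub>0 \<xi>\<^sub>0] K_def by simp
      finally show ?thesis .
    qed (simp add: K_def)
    then have "cmod (q (x\<^sub>0, \<xi>\<^sub>0)) * exp (- (1 / 2)) \<le> K + 2 * M"
      unfolding b_def by simp
    then show ?thesis
      unfolding D_def by (simp add: exp_minus field_simps)
  qed
  have "(SUP (x, \<xi>)\<in>UNIV. ereal (cmod (q (x, \<xi>)))) \<le> ereal D"
    by (rule SUP_least) (auto simp: bound)
  then show ?thesis
    by (rule le_less_trans) simp
qed

end
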